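(* Let $P$ be any monotone property of boxes and let $\mathcal{B}_1,\dots,\mathcal{B}_{2d}$ be finite families of boxes in $\mathbb{R}^d$. If for every choice $B_i\in\mathcal{B}_i$, $i\in\{1,\dots,2d\}$, the family $\{B_1,\dots,B_{2d}\}$ is $P$-intersecting, then there exists an $\ell\in\{1,\dots,2d\}$ such that $\mathcal{B}_\ell$ is $P$-intersecting.
   Context: A box in $\mathbb{R}^d$ is an axis-parallel box, i.e. a set of the form $[a_1,b_1]\times\cdots\times[a_d,b_d]$ (an intersection of $2d$ closed coordinate halfspaces, one for each direction $\pm e_i$); degenerate boxes and the empty set are allowed, so that an intersection of boxes is a box. A property $P$ of boxes (a class of boxes) is monotone if $B\in P$ and $B\subseteq C$ imply $C\in P$ for all boxes $B,C$. A family of boxes is $P$-intersecting if the intersection of its members has property $P$. *)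

theory Defs
  imports "HOL-Analysis.Analysis"
begin

(* cbox a b is the product of the intervals [a$i, b$i]. It may be degenerate, and it is
   empty as soon as b$i < a$i for some i, so the empty set is a box. *)
definition boxes :: "(real ^ 'd) set set" where
  "boxes = {cbox a b | a b. True}"

definition box_property :: "(real ^ 'd) set set \<Rightarrow> bool" where
  "box_property P \<longleftrightarrow> P \<subseteq> boxes"

definition monotone_property :: "(real ^ 'd) set set \<Rightarrow> bool" where
  "monotone_property P \<longleftrightarrow> (\<forall>B\<in>boxes. \<forall>C\<in>boxes. B \<in> P \<and> B \<subseteq> C \<longrightarrow> C \<in> P)"

(* The intersection of the empty family is UNIV, which is not a box; the empty family is
   therefore not P-intersecting for any property P of boxes. *)
definition P_intersecting :: "(real ^ 'd) set set \<Rightarrow> (real ^ 'd) set set \<Rightarrow> bool" where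
  "P_intersecting P F \<longleftrightarrow> \<Inter>F \<in> P"

end

theory Submission
  imports Defs
begin

text \<open>
  A box is cut out by one halfspace for each of the \<open>2d\<close> directions, and parallel halfspaces with
  the same outward direction are linearly ordered by inclusion. Hence there is a greedy choice: go
  through the directions one by one, and for each direction take, among all families that have not
  yet been used, a box whose halfspace in that direction is smallest; the family it comes from is
  then used. There are as many families as directions, so exactly one family \<open>l\<close> is left for the
  last direction, and it contributes its own smallest halfspace there. Since \<open>l\<close> competed in every
  earlier step, the box chosen for a direction is at least as tight in that direction as every
  member of \<open>l\<close>. The intersection of the chosen boxes is therefore contained in the intersection of
  family \<open>l\<close>, and monotonicity of the property finishes the argument.

  The greedy choice is purely order-theoretic (\<open>greedy_transversal\<close>). It bounds numbers that
  describe the boxes, not the boxes themselves, and so the empty box is no exception: it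
  suffices to fix one description \<open>cbox a b\<close> of it, which is still the intersection of its \<open>2d\<close>
  halfspaces.
\<close>

text \<open>
  Here \<open>h v b\<close> is the position of the halfspace of \<open>b\<close> in direction \<open>v\<close>; smaller means tighter.
  The induction removes a direction together with the family that wins it, and it starts from a
  single direction because the surviving family has to win the last one itself.
\<close>

lemma greedy_transversal:
  fixes h :: "'v \<Rightarrow> 'b \<Rightarrow> 'c::linorder" and F :: "'i \<Rightarrow> 'b set"
  assumes "finite D" "D \<noteq> {}" "finite I" "card I = card D"
    and "\<And>i. i \<in> I \<Longrightarrow> finite (F i) \<and> F i \<noteq> {}"
  shows "\<exists>l\<in>I. \<exists>B. (\<forall>i\<in>I. B i \<in> F i) \<and> (\<forall>v\<in>D. \<exists>i\<in>I. \<forall>C\<in>F l. h v (B i) \<le> h v C)"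
  using assms
proof (induction D arbitrary: I rule: finite_ne_induct)
  case (singleton v)
  then obtain l where I: "I = {l}"
    by (auto simp: card_1_singleton_iff)
  then have "finite (F l)" "F l \<noteq> {}"
    using singleton.prems(3) by auto
  then obtain m where "m \<in> F l" "\<forall>C\<in>F l. h v m \<le> h v C"
    using arg_min_if_finite(1)[of "F l" "h v"] arg_min_least[of "F l" _ "h v"] by blast
  then show ?case
    unfolding I by (intro bexI[of _ l] exI[of _ "\<lambda>_. m"]) auto
next
  case (insert v D)
  let ?U = "\<Union>i\<in>I. F i"
  have "I \<noteq> {}"
    using insert.hyps insert.prems(2) by auto
  then have U: "finite ?U" "?U \<noteq> {}"
    using insert.prems(1,3) by auto
  then obtain m where "m \<in> ?U" and m_least: "\<And>C. C \<in> ?U \<Longrightarrow> h v m \<le> h v C"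
    using arg_min_if_finite(1)[of ?U "h v"] arg_min_least[of ?U _ "h v"] by blast
  then obtain j where j: "j \<in> I" "m \<in> F j"
    by blast
  have "card (I - {j}) = card D"
    using insert.hyps insert.prems(1,2) j by simp
  then obtain l B where l: "l \<in> I - {j}" and B: "\<forall>i\<in>I - {j}. B i \<in> F i"
    and tight: "\<forall>w\<in>D. \<exists>i\<in>I - {j}. \<forall>C\<in>F l. h w (B i) \<le> h w C"
    using insert.IH[of "I - {j}"] insert.prems(1,3) by auto
  define B' where "B' = B(j := m)"
  have "\<forall>i\<in>I. B' i \<in> F i"
    using B j by (auto simp: B'_def)
  moreover have "\<exists>i\<in>I. \<forall>C\<in>F l. h w (B' i) \<le> h w C" if "w \<in> insert v D" for w
  proof (cases "w = v")
    case True
    have "\<forall>C\<in>F l. h v (B' j) \<le> h v C"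
      using m_least l by (auto simp: B'_def)
    with True j show ?thesis by blast
  next
    case False
    with that tight obtain i where "i \<in> I - {j}" "\<forall>C\<in>F l. h w (B i) \<le> h w C"
      by blast
    then show ?thesis
      by (intro bexI[of _ i]) (auto simp: B'_def)
  qed
  ultimately show ?case
    using l by blast
qed

lemma boxes_Inter:
  assumes "finite F" "F \<noteq> {}" "F \<subseteq> boxes"
  shows "\<Inter>F \<in> boxes"
  using assms
proof (induction F rule: finite_ne_induct)
  case (insert A F)
  then obtain a b c d where "A = cbox a b" "\<Inter>F = cbox c d"
    by (auto simp: boxes_def)
  then show ?case
    by (auto simp: boxes_def Int_interval)
qed simp

theorem corollary1p4:
  fixes P :: "(real ^ 'd) set set"
    and \<B> :: "nat \<Rightarrow> (real ^ 'd) set set"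
  assumes "box_property P" and "monotone_property P"
    and "\<And>i. i \<in> {1..2 * CARD('d)} \<Longrightarrow> finite (\<B> i) \<and> \<B> i \<noteq> {} \<and> \<B> i \<subseteq> boxes"
    and "\<And>B :: nat \<Rightarrow> (real ^ 'd) set. (\<forall>i\<in>{1..2 * CARD('d)}. B i \<in> \<B> i) \<Longrightarrow>
           P_intersecting P (B ` {1..2 * CARD('d)})"
  shows "\<exists>l\<in>{1..2 * CARD('d)}. P_intersecting P (\<B> l)"
proof -
  let ?I = "{1..2 * CARD('d)}"
  have "\<forall>X\<in>boxes. \<exists>a b. X = cbox a (b :: real ^ 'd)"
    by (auto simp: boxes_def)
  then obtain lo hi where box: "\<And>X. X \<in> boxes \<Longrightarrow> X = cbox (lo X) (hi X :: real ^ 'd)"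
    by metis
  \<comment> \<open>The direction \<open>(k, True)\<close> is \<open>e\<^sub>k\<close>, and \<open>(k, False)\<close> is \<open>-e\<^sub>k\<close>; the sign makes a tighter
      lower bound count as smaller.\<close>
  define h :: "'d \<times> bool \<Rightarrow> (real ^ 'd) set \<Rightarrow> real"
    where "h = (\<lambda>(k, upper) X. if upper then hi X $ k else - (lo X $ k))"
  have mem_box: "x \<in> X \<longleftrightarrow> (\<forall>k. - (x $ k) \<le> h (k, False) X \<and> x $ k \<le> h (k, True) X)"
    if "X \<in> boxes" for x X
    by (subst box[OF that]) (auto simp: h_def mem_box_cart)
  have "card ?I = card (UNIV :: ('d \<times> bool) set)"
    by (simp add: card_cartesian_product flip: UNIV_Times_UNIV)
  then obtain l B where l: "l \<in> ?I" and B: "\<forall>i\<in>?I. B i \<in> \<B> i"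
    and tight: "\<And>v. \<exists>i\<in>?I. \<forall>C\<in>\<B> l. h v (B i) \<le> h v C"
    using greedy_transversal[of "UNIV :: ('d \<times> bool) set" ?I \<B> h] assms(3) by auto
  have "\<Inter>(B ` ?I) \<subseteq> \<Inter>(\<B> l)"
  proof (intro subsetI InterI)
    fix x C
    assume x: "x \<in> \<Inter>(B ` ?I)" and C: "C \<in> \<B> l"
    have x_le: "- (x $ k) \<le> h (k, False) (B i)" "x $ k \<le> h (k, True) (B i)" if "i \<in> ?I" for i k
      using mem_box[of "B i" x] x B assms(3) that by blast+
    have "- (x $ k) \<le> h (k, False) C" "x $ k \<le> h (k, True) C" for k
      using x_le tight[of "(k, False)"] tight[of "(k, True)"] C by (meson order_trans)+
    moreover have "C \<in> boxes"
      using C l assms(3) by blast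
    ultimately show "x \<in> C"
      by (simp add: mem_box)
  qed
  moreover have "\<Inter>(B ` ?I) \<in> P"
    using assms(4)[OF B] by (simp add: P_intersecting_def)
  moreover have "\<Inter>(\<B> l) \<in> boxes"
    using assms(3)[OF l] by (intro boxes_Inter) auto
  ultimately have "\<Inter>(\<B> l) \<in> P"
    using assms(1,2) unfolding box_property_def monotone_property_def by blast
  with l show ?thesis
    unfolding P_intersecting_def by blast
qed

end
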